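(* Let $A\in\mathbb{R}^{r\times n}$ be a configuration of rank $r$ with columns $a_1,\dots,a_n$, and let $S\subseteq[n]$ be right-completable to (the zero-set of) a cocircuit $C_0^*$ of $A$. Then: (i) For the set $R:=\{i\in[n]: i>\max S\}$ the rank bound $\operatorname{rank}(A_{S\cup R})\ge r-1$ holds. (ii) For all $i\in[n]\setminus S$ with $i<\max S$ the rank bound $\operatorname{rank}(A_S)<\operatorname{rank}(A_{S\cup\{i\}})$ holds.
   Context: $[n]=\{1,\dots,n\}$. For $S\subseteq[n]$, $A_S$ denotes the submatrix of the columns with indices in $S$. $S$ is coplanar if $\operatorname{rank}(A_S)<r$. A cocircuit (its zero part) is an inclusion-maximal coplanar subset of $[n]$. $S$ is right-completable to $C_0^*$ if $S\subseteq C_0^*$ and every element of $C_0^*\setminus S$ is larger than every element of $S$. For $S=\emptyset$ the conventions are that $R=[n]$ and (ii) is void. *)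

theory Defs
  imports "Jordan_Normal_Form.DL_Rank" "Jordan_Normal_Form.DL_Submatrix"
begin

text \<open>
  Column index sets are subsets of \<open>[n] = {1..n}\<close>, whereas matrices count columns from 0: the
  column \<open>a\<^sub>i\<close> is \<open>col A (i - 1)\<close>.
\<close>

definition column_submatrix :: "'a mat \<Rightarrow> nat set \<Rightarrow> 'a mat" where
  "column_submatrix A S = submatrix A UNIV {j. Suc j \<in> S}"

lemma set_cols_column_submatrix:
  assumes "S \<subseteq> {1..dim_col A}"
  shows "set (cols (column_submatrix A S)) = (\<lambda>i. col A (i - 1)) ` S"
proof -
  define J where "J = {j. Suc j \<in> S}"
  define m where "m = card {j. j < dim_col A \<and> j \<in> J}"
  have J: "J \<subseteq> {..<dim_col A}" using assms by (auto simp: J_def)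
  have "{j. j < dim_col A \<and> j \<in> J} = J" using J by blast
  then have m: "m = card J" by (simp add: m_def)
  have fin: "finite J" using J finite_subset by blast
  have dims: "dim_row (submatrix A UNIV J) = dim_row A" "dim_col (submatrix A UNIV J) = m"
    by (simp_all add: dim_submatrix m_def)
  have col: "col (submatrix A UNIV J) k = col A (pick J k)" if "k < m" for k
  proof (rule eq_vecI)
    have k: "pick J k < dim_col A" using that J pick_in_set_le[of k J] m by auto
    fix i assume "i < dim_vec (col A (pick J k))"
    then have i: "i < dim_row A" by simp
    have "submatrix A UNIV J $$ (i, k) = A $$ (pick UNIV i, pick J k)"
      by (rule submatrix_index) (use i that in \<open>simp_all add: m_def\<close>)
    then show "col (submatrix A UNIV J) k $ i = col A (pick J k) $ i"
      using i k that dims by (simp add: pick_UNIV)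
  qed (simp add: dims)
  have pick: "pick J ` {..<m} = J"
  proof (rule card_subset_eq[OF fin])
    show "pick J ` {..<m} \<subseteq> J" using m pick_in_set_le by auto
    have "inj_on (pick J) {..<m}"
      by (rule inj_onI) (metis lessThan_iff linorder_neqE_nat m order_less_irrefl pick_mono_le)
    then show "card (pick J ` {..<m}) = card J" by (simp add: card_image m)
  qed
  have S: "S = Suc ` J"
  proof
    show "S \<subseteq> Suc ` J"
    proof
      fix i assume "i \<in> S"
      with assms have "i \<noteq> 0" by auto
      then obtain j where "i = Suc j" using not0_implies_Suc by blast
      with \<open>i \<in> S\<close> show "i \<in> Suc ` J" by (simp add: J_def)
    qed
  qed (auto simp: J_def)
  have "set (cols (submatrix A UNIV J)) = col (submatrix A UNIV J) ` {..<m}"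
    by (simp add: cols_def dims atLeast0LessThan)
  also have "\<dots> = (\<lambda>k. col A (pick J k)) ` {..<m}"
    by (rule image_cong) (simp_all add: col)
  also have "\<dots> = col A ` pick J ` {..<m}"
    by (simp only: image_image)
  also have "\<dots> = (\<lambda>i. col A (i - 1)) ` S"
    by (simp only: pick S image_image diff_Suc_1)
  finally show ?thesis
    by (simp only: column_submatrix_def J_def)
qed

definition column_rank :: "'a::field mat \<Rightarrow> nat set \<Rightarrow> nat" where
  "column_rank A S = vec_space.rank (dim_row A) (column_submatrix A S)"

text \<open>The number of rows plays the role of \<open>r\<close>; configurations have full row rank.\<close>

definition coplanar :: "'a::field mat \<Rightarrow> nat set \<Rightarrow> bool" where
  "coplanar A S \<longleftrightarrow> column_rank A S < dim_row A"

definition cocircuit_zero_set :: "'a::field mat \<Rightarrow> nat set \<Rightarrow> bool" where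
  "cocircuit_zero_set A C \<longleftrightarrow>
     C \<subseteq> {1..dim_col A} \<and> coplanar A C \<and>
     (\<forall>D. D \<subseteq> {1..dim_col A} \<and> coplanar A D \<and> C \<subseteq> D \<longrightarrow> D = C)"

definition right_completable :: "nat set \<Rightarrow> nat set \<Rightarrow> bool" where
  "right_completable S C \<longleftrightarrow> S \<subseteq> C \<and> (\<forall>j \<in> C - S. \<forall>s \<in> S. s < j)"

text \<open>\<open>Max {}\<close> is unspecified; the empty set has all of \<open>[n]\<close> to its right by convention.\<close>

definition right_of :: "nat \<Rightarrow> nat set \<Rightarrow> nat set" where
  "right_of n S = (if S = {} then {1..n} else {i \<in> {1..n}. i > Max S})"

end

theory Submission
  imports Defs
begin

text \<open>
  By maximality the zero set \<open>C\<^sub>0\<close> of a cocircuit is a flat of rank at least \<open>r - 1\<close>: adding any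
  column outside \<open>C\<^sub>0\<close> raises the rank to \<open>r\<close>. Right-completability gives \<open>C\<^sub>0 \<subseteq> S \<union> R\<close>, which
  yields (i), and says that an index \<open>i < max S\<close> outside \<open>S\<close> is not in \<open>C\<^sub>0\<close>; then \<open>a\<^sub>i\<close> is outside the
  span of \<open>C\<^sub>0\<close>, hence outside the span of \<open>S\<close>, which yields (ii).
\<close>

context vectorspace
begin

lemma lin_indpt_insert:
  assumes "U \<subseteq> carrier V" "lin_indpt U" "v \<in> carrier V" "v \<notin> span U"
  shows "lin_indpt (insert v U)"
proof -
  have "v \<notin> U" using assms span_mem by blast
  then show ?thesis using lin_dep_iff_in_span[OF assms(1-3)] assms(4) by simp
qed

text \<open>Greedy selection: run through \<open>S\<close> and keep \<open>v\<close> only if it lies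
  outside the span of the vectors kept so far.\<close>

lemma obtain_lin_indpt_spanning:
  assumes "finite S" "S \<subseteq> carrier V"
  obtains U where "U \<subseteq> S" "lin_indpt U" "S \<subseteq> span U"
proof -
  have "\<exists>U \<subseteq> S. lin_indpt U \<and> S \<subseteq> span U"
    using assms
  proof (induction S rule: finite_induct)
    case empty
    have "lin_indpt {}" by (simp add: lindep_span)
    then show ?case by blast
  next
    case (insert v S)
    then obtain U where U: "U \<subseteq> S" "lin_indpt U" "S \<subseteq> span U" by auto
    with insert.prems have UV: "U \<subseteq> carrier V" and v: "v \<in> carrier V" by auto
    show ?case
    proof (cases "v \<in> span U")
      case True
      then show ?thesis using U by (intro exI[of _ U]) auto
    next
      case False
      have "S \<subseteq> span (insert v U)"
        using U(3) span_is_monotone[of U "insert v U"] by blast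
      moreover have "v \<in> span (insert v U)"
        using span_mem[of "insert v U" v] UV v by simp
      ultimately show ?thesis
        using U lin_indpt_insert[OF UV U(2) v False] by (intro exI[of _ "insert v U"]) auto
    qed
  qed
  then show thesis using that by blast
qed

text \<open>\<open>U\<close> is a maximal independent subset of \<open>S\<close>: any further
  \<open>t\<close> in \<open>S\<close> already lies in \<open>span U\<close> and would create a
  dependence.\<close>

lemma dim_span_eq_card:
  assumes "finite S" "S \<subseteq> carrier V" "U \<subseteq> S" "lin_indpt U" "S \<subseteq> span U"
  shows "vectorspace.dim K (span_vs S) = card U"
proof (rule dim_span[OF assms(2,1)])
  have UV: "U \<subseteq> carrier V" using assms by blast
  have "T \<subseteq> U" if T: "U \<subseteq> T" "T \<subseteq> S" "lin_indpt T" for T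
  proof
    fix t assume t: "t \<in> T"
    show "t \<in> U"
    proof (rule ccontr)
      assume "t \<notin> U"
      moreover have "lin_indpt (U \<union> {t})"
        by (rule subset_li_is_li[OF T(3)]) (use t T(1) in blast)
      moreover have "t \<in> span U" "t \<in> carrier V" using t T(2) assms(2,5) by auto
      ultimately show False by (simp add: lin_dep_iff_in_span[OF UV assms(4)])
    qed
  qed
  then show "maximal U (\<lambda>T. T \<subseteq> S \<and> lin_indpt T)"
    using assms(3,4) unfolding maximal_def by blast
qed

text \<open>Take a basis \<open>U\<close> of \<open>span S\<close> inside \<open>S\<close>. It still
  spans after adding \<open>v\<close> if \<open>v\<close> is in \<open>span S\<close>; otherwise
  \<open>insert v U\<close> is independent and has one more element.\<close>

lemma dim_span_insert:
  assumes "finite S" "S \<subseteq> carrier V" "v \<in> carrier V"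
  shows "vectorspace.dim K (span_vs (insert v S)) =
    vectorspace.dim K (span_vs S) + (if v \<in> span S then 0 else 1)"
proof -
  obtain U where U: "U \<subseteq> S" "lin_indpt U" "S \<subseteq> span U"
    using obtain_lin_indpt_spanning[OF assms(1,2)] .
  have UV: "U \<subseteq> carrier V" using U assms by blast
  have sp: "span S = span U"
    using U span_is_monotone[OF U(1)] span_is_subset[OF U(3) span_is_submodule[OF UV]] by blast
  have fin: "finite (insert v S)" and carr: "insert v S \<subseteq> carrier V" using assms by auto
  have dimS: "vectorspace.dim K (span_vs S) = card U"
    by (rule dim_span_eq_card[OF assms(1,2) U])
  show ?thesis
  proof (cases "v \<in> span S")
    case True
    then have "vectorspace.dim K (span_vs (insert v S)) = card U"
      using U sp by (intro dim_span_eq_card fin carr) auto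
    then show ?thesis using True dimS by simp
  next
    case False
    then have v: "v \<notin> span U" "v \<notin> U" using sp span_mem[OF UV] by auto
    have "S \<subseteq> span (insert v U)"
      using U(3) span_is_monotone[of U "insert v U"] by blast
    moreover have "v \<in> span (insert v U)"
      using span_mem[of "insert v U" v] UV assms(3) by simp
    ultimately have "vectorspace.dim K (span_vs (insert v S)) = card (insert v U)"
      using U lin_indpt_insert[OF UV U(2) assms(3) v(1)]
      by (intro dim_span_eq_card fin carr) auto
    moreover have "finite U" using U(1) assms(1) finite_subset by blast
    ultimately show ?thesis using False dimS v(2) by simp
  qed
qed

end

text \<open>Generated by the image of \<open>S\<close> rather than by
  \<open>column_submatrix A S\<close>, so that enlarging \<open>S\<close> directly enlarges the
  generating set.\<close>

definition column_span :: "'a::field mat \<Rightarrow> nat set \<Rightarrow> 'a vec set" where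
  "column_span A S = LinearCombinations.module.span class_ring
     (module_vec TYPE('a) (dim_row A)) ((\<lambda>i. col A (i - 1)) ` S)"

lemma column_span_mono:
  fixes A :: "'a::field mat"
  assumes "S \<subseteq> T"
  shows "column_span A S \<subseteq> column_span A T"
proof -
  interpret vec_space "TYPE('a)" "dim_row A" .
  show ?thesis unfolding column_span_def
    by (rule span_is_monotone) (use assms in blast)
qed

text \<open>Rank depends only on the set of columns, so repeated columns do no harm: a copy of a
  column from \<open>S\<close> lies in the span and adds 0.\<close>

lemma column_rank_insert:
  fixes A :: "'a::field mat"
  assumes "S \<subseteq> {1..dim_col A}" "i \<in> {1..dim_col A}"
  shows "column_rank A (insert i S) =
    column_rank A S + (if col A (i - 1) \<in> column_span A S then 0 else 1)"
proof -
  interpret vec_space "TYPE('a)" "dim_row A" .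
  have "finite S" using assms(1) finite_subset by blast
  then show ?thesis
    using dim_span_insert[of "(\<lambda>i. col A (i - 1)) ` S" "col A (i - 1)"] assms
    by (simp add: column_rank_def rank_def set_cols_column_submatrix column_span_def
        image_subset_iff)
qed

lemma column_rank_mono:
  assumes "S \<subseteq> T" "T \<subseteq> {1..dim_col A}"
  shows "column_rank A S \<le> column_rank A T"
proof -
  \<comment> \<open>Indices are added one at a time, each raising the rank by 0 or 1; the claim is
    the case \<open>F = T\<close>.\<close>
  have "column_rank A S \<le> column_rank A (S \<union> F)"
    if "finite F" "S \<union> F \<subseteq> {1..dim_col A}" for F
    using that
  proof (induction F rule: finite_induct)
    case empty
    then show ?case by simp
  next
    case (insert i F)
    then have "column_rank A S \<le> column_rank A (S \<union> F)" by simp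
    also have "\<dots> \<le> column_rank A (S \<union> insert i F)"
      using insert.prems column_rank_insert[of "S \<union> F" A i] by simp
    finally show ?case .
  qed
  moreover have "finite T" using assms(2) finite_subset by blast
  ultimately show ?thesis using assms by (metis Un_absorb1)
qed

text \<open>Carries the full-rank hypothesis on \<open>A\<close> over to
  \<open>column_rank\<close>.\<close>

lemma column_rank_all:
  "column_rank A {1..dim_col A} = vec_space.rank (dim_row A) A"
proof -
  have "(\<lambda>i. col A (i - 1)) ` {1..dim_col A} = set (cols A)"
    by (simp add: cols_def atLeast0LessThan image_image
        flip: image_Suc_lessThan del: One_nat_def)
  then show ?thesis
    by (simp add: column_rank_def vec_space.rank_def set_cols_column_submatrix)
qed

lemma column_rank_insert_cocircuit_zero_set:
  assumes "cocircuit_zero_set A C" "i \<in> {1..dim_col A} - C"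
  shows "dim_row A \<le> column_rank A (insert i C)"
proof (rule ccontr)
  assume "\<not> dim_row A \<le> column_rank A (insert i C)"
  then have "coplanar A (insert i C)" by (simp add: coplanar_def)
  moreover have "insert i C \<subseteq> {1..dim_col A}" "C \<subseteq> insert i C"
    using assms by (auto simp: cocircuit_zero_set_def)
  ultimately have "insert i C = C"
    using assms(1) unfolding cocircuit_zero_set_def by blast
  then show False using assms(2) by blast
qed

text \<open>A column inside the span would leave the rank of \<open>C\<close> below
  \<open>dim_row A\<close> after insertion, against maximality.\<close>

lemma col_notin_column_span_cocircuit_zero_set:
  assumes "cocircuit_zero_set A C" "i \<in> {1..dim_col A} - C"
  shows "col A (i - 1) \<notin> column_span A C"
proof
  assume "col A (i - 1) \<in> column_span A C"
  moreover have "C \<subseteq> {1..dim_col A}" "column_rank A C < dim_row A"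
    using assms(1) by (auto simp: cocircuit_zero_set_def coplanar_def)
  ultimately show False
    using column_rank_insert_cocircuit_zero_set[OF assms] column_rank_insert[of C A i] assms(2) by simp
qed

text \<open>Full rank makes \<open>C\<close> a proper subset of the indices, and the one column that
  lifts the rank to \<open>dim_row A\<close> contributes at most 1. The form with \<open>+ 1\<close>
  avoids truncated subtraction.\<close>

lemma column_rank_cocircuit_zero_set:
  assumes "cocircuit_zero_set A C" "vec_space.rank (dim_row A) A = dim_row A"
  shows "dim_row A \<le> column_rank A C + 1"
proof -
  have C: "C \<subseteq> {1..dim_col A}" "column_rank A C < dim_row A"
    using assms(1) by (auto simp: cocircuit_zero_set_def coplanar_def)
  have "C \<noteq> {1..dim_col A}"
    using C(2) assms(2) by (metis column_rank_all less_irrefl)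
  then obtain i where i: "i \<in> {1..dim_col A} - C" using C(1) by blast
  have "column_rank A (insert i C) \<le> column_rank A C + 1"
    using column_rank_insert[of C A i] C(1) i by simp
  then show ?thesis using column_rank_insert_cocircuit_zero_set[OF assms(1) i] by linarith
qed

theorem theorem6:
  fixes A :: "real mat" and r n :: nat and S C\<^sub>0 :: "nat set"
  assumes "A \<in> carrier_mat r n"
    and "vec_space.rank r A = r"
    and "S \<subseteq> {1..n}"
    and "cocircuit_zero_set A C\<^sub>0"
    and "right_completable S C\<^sub>0"
  shows "int (column_rank A (S \<union> right_of n S)) \<ge> int r - 1 \<and>
         (S \<noteq> {} \<longrightarrow>
           (\<forall>i \<in> {1..n} - S. i < Max S \<longrightarrow> column_rank A S < column_rank A (S \<union> {i})))"
proof (intro conjI impI ballI)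
  have dims: "dim_row A = r" "dim_col A = n" using assms(1) by auto
  have C: "C\<^sub>0 \<subseteq> {1..n}" using assms(4) dims by (simp add: cocircuit_zero_set_def)
  have fin: "finite S" using assms(3) finite_subset by blast
  have SC: "S \<subseteq> C\<^sub>0" and right: "\<And>j s. j \<in> C\<^sub>0 - S \<Longrightarrow> s \<in> S \<Longrightarrow> s < j"
    using assms(5) by (auto simp: right_completable_def)
  \<comment> \<open>For nonempty \<open>S\<close>, an element of \<open>C\<^sub>0 - S\<close>
    exceeds every element of \<open>S\<close>, in particular \<open>Max S\<close>; for empty
    \<open>S\<close> the right part is all of \<open>{1..n}\<close>.\<close>
  have "C\<^sub>0 \<subseteq> S \<union> right_of n S"
    using C right fin by (auto simp: right_of_def)
  moreover have "S \<union> right_of n S \<subseteq> {1..n}" using assms(3) by (auto simp: right_of_def)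
  ultimately have "column_rank A C\<^sub>0 \<le> column_rank A (S \<union> right_of n S)"
    using column_rank_mono dims by metis
  moreover have "r \<le> column_rank A C\<^sub>0 + 1"
    using column_rank_cocircuit_zero_set[OF assms(4)] assms(2) dims by simp
  ultimately show "int (column_rank A (S \<union> right_of n S)) \<ge> int r - 1" by linarith
  fix i assume "S \<noteq> {}" and i: "i \<in> {1..n} - S" "i < Max S"
  then have "Max S \<in> S" using fin by simp
  \<comment> \<open>Otherwise right-completability would force \<open>Max S < i\<close>.\<close>
  then have "i \<notin> C\<^sub>0" using right[of i "Max S"] i by auto
  then have "col A (i - 1) \<notin> column_span A C\<^sub>0"
    using col_notin_column_span_cocircuit_zero_set[OF assms(4)] i dims by simp
  then have "col A (i - 1) \<notin> column_span A S" using column_span_mono[OF SC] by blast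
  then show "column_rank A S < column_rank A (S \<union> {i})"
    using column_rank_insert[of S A i] assms(3) i dims by simp
qed

end
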